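(* For any wedge pattern $\tau\in S_k$ that avoids $132$, $F_\tau(x)=R_k(x)$.
   Context: A permutation $\alpha\in S_n$ contains a pattern $\tau\in S_k$ if there are indices $1\le i_1<\dots<i_k\le n$ with $(\alpha_{i_1},\dots,\alpha_{i_k})$ order-isomorphic to $\tau$; otherwise it avoids $\tau$. For a pattern $\tau$, $f_\tau(n)$ is the number of permutations in $S_n$ avoiding both $132$ and $\tau$ ($S_0$ consists of the empty permutation), and $F_\tau(x)=\sum_{n\ge0}f_\tau(n)x^n$. Layered permutations: for integers $s=m_0>m_1>\dots>m_q>m_{q+1}=0$, the layered permutation $[m_0,\dots,m_q]$ of $\{1,\dots,s\}$ is the concatenation of the increasing blocks $(m_{i+1}+1,\dots,m_i)$ for $i=0,1,\dots,q$. A permutation $\tau\in S_k$ is a wedge pattern if it can be written as a concatenation $\tau=(\tau^1,\rho^1,\tau^2,\rho^2,\dots,\tau^r,\rho^r)$ of consecutive segments such that every $\tau^i$ is nonempty (the $\rho^i$ may be empty), the concatenation $(\rho^1,\rho^2,\dots,\rho^r)$ is a layered permutation of $\{1,\dots,s\}$ for some $s\ge0$, and the concatenation $(\tau^1,\tau^2,\dots,\tau^r)$ equals $(s+1,s+2,\dots,k)$. For example, $645783912$ and $456378129$ are wedge patterns. $U_p$ is the Chebyshev polynomial of the second kind, $U_p(\cos\theta)=\sin((p+1)\theta)/\sin\theta$, and $R_k(x)=\dfrac{U_{k-1}\left(\frac1{2\sqrt x}\right)}{\sqrt x\,U_k\left(\frac1{2\sqrt x}\right)}$ (a rational function of $x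$).
   Formalization: The definition of wedge pattern is read with the extra condition that each segment ρ^i is increasing (lies within one layer); without it the claim fails, e.g. τ=321=((3),(2,1)), where f_τ(4)=7 but R_3 has x^4-coefficient 8. *)

theory Defs
  imports
    "HOL-Combinatorics.Multiset_Permutations"
    "HOL-Computational_Algebra.Polynomial"
    "HOL-Computational_Algebra.Formal_Laurent_Series"
begin

section \<open>Pattern containment in permutations\<close>

text \<open>Permutations are given in one-line notation: the elements of \<open>S_n\<close> are the lists in
  \<^term>\<open>permutations_of_set {1..n}\<close>. Positions in lists are counted from 0.\<close>

definition contains_pattern :: "nat list \<Rightarrow> nat list \<Rightarrow> bool" where
  "contains_pattern \<alpha> \<tau> \<longleftrightarrow>
     (\<exists>i :: nat \<Rightarrow> nat. strict_mono_on {..<length \<tau>} i \<and> (\<forall>a<length \<tau>. i a < length \<alpha>) \<and>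
        (\<forall>a<length \<tau>. \<forall>b<length \<tau>. \<alpha> ! i a < \<alpha> ! i b \<longleftrightarrow> \<tau> ! a < \<tau> ! b))"

abbreviation avoids_pattern :: "nat list \<Rightarrow> nat list \<Rightarrow> bool" where
  "avoids_pattern \<alpha> \<tau> \<equiv> \<not> contains_pattern \<alpha> \<tau>"

definition avoid_count :: "nat list \<Rightarrow> nat \<Rightarrow> nat" where
  "avoid_count \<tau> n =
     card {\<alpha> \<in> permutations_of_set {1..n}. avoids_pattern \<alpha> [1, 3, 2] \<and> avoids_pattern \<alpha> \<tau>}"

definition avoid_gf :: "nat list \<Rightarrow> real fps" where
  "avoid_gf \<tau> = Abs_fps (\<lambda>n. of_nat (avoid_count \<tau> n))"

section \<open>Layered permutations and wedge patterns\<close>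

text \<open>For \<open>ms = [m_0, \<dots>, m_q]\<close>, the list \<open>ms @ [0]\<close> is \<open>[m_0, \<dots>, m_{q+1}]\<close>.
  The empty list \<open>ms\<close> yields the empty permutation, the layered permutation for \<open>s = 0\<close>.\<close>

definition layered :: "nat list \<Rightarrow> nat list" where
  "layered ms = concat (map (\<lambda>i. [(ms @ [0]) ! Suc i + 1 ..< (ms @ [0]) ! i + 1]) [0..<length ms])"

definition layered_perm :: "nat \<Rightarrow> nat list \<Rightarrow> bool" where
  "layered_perm s xs \<longleftrightarrow>
     (\<exists>ms. sorted_wrt (>) (ms @ [0]) \<and> hd (ms @ [0]) = s \<and> xs = layered ms)"

text \<open>The list \<open>ps\<close> is \<open>[(\<tau>\<^sup>1, \<rho>\<^sup>1), \<dots>, (\<tau>\<^sup>r, \<rho>\<^sup>r)]\<close>.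

  The condition \<^term>\<open>sorted \<rho>\<close> says that no single segment \<open>\<rho>\<^sup>i\<close> meets two different layers of
  the layered permutation \<open>(\<rho>\<^sup>1, \<dots>, \<rho>\<^sup>r)\<close> (an increasing segment of a layered permutation lies in
  one layer). The usual wording of the definition does not state this condition, but without it
  \<open>321 = ((3), (2,1))\<close> would be a wedge pattern, and \<open>F_\<tau> = R_k\<close> fails for \<open>321\<close>:
  of the 14 permutations in \<open>S_4\<close> avoiding 132, 7 avoid 321, whereas \<open>R_3 = (1-x)/(1-2x)\<close> has
  \<open>x^4\<close>-coefficient 8.\<close>

definition wedge_pattern :: "nat \<Rightarrow> nat list \<Rightarrow> bool" where
  "wedge_pattern k \<tau> \<longleftrightarrow>
     \<tau> \<in> permutations_of_set {1..k} \<and>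
     (\<exists>ps s. ps \<noteq> [] \<and> \<tau> = concat (map (\<lambda>(t, \<rho>). t @ \<rho>) ps) \<and>
        (\<forall>(t, \<rho>) \<in> set ps. t \<noteq> [] \<and> sorted \<rho>) \<and>
        layered_perm s (concat (map snd ps)) \<and>
        concat (map fst ps) = [s + 1 ..< k + 1])"

section \<open>Chebyshev polynomials of the second kind\<close>

definition chebyshev_U :: "nat \<Rightarrow> real poly" where
  "chebyshev_U p =
     (THE P. \<forall>\<theta>. sin \<theta> \<noteq> 0 \<longrightarrow> poly P (cos \<theta>) = sin (real (p + 1) * \<theta>) / sin \<theta>)"

lemma chebyshev_U_unique:
  assumes P: "\<forall>\<theta>. sin \<theta> \<noteq> 0 \<longrightarrow> poly P (cos \<theta>) = sin (real (p + 1) * \<theta>) / sin \<theta>"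
    and Q: "\<forall>\<theta>. sin \<theta> \<noteq> 0 \<longrightarrow> poly Q (cos \<theta>) = sin (real (p + 1) * \<theta>) / sin \<theta>"
  shows "P = (Q :: real poly)"
proof (rule ccontr)
  assume "P \<noteq> Q"
  hence "finite {x. poly (P - Q) x = 0}" by (intro poly_roots_finite) simp
  moreover have "{0<..<1::real} \<subseteq> {x. poly (P - Q) x = 0}"
  proof
    fix x :: real assume x: "x \<in> {0<..<1}"
    hence "x\<^sup>2 < 1" by (simp add: abs_square_less_1)
    hence "sin (arccos x) \<noteq> 0" using x by (simp add: sin_arccos)
    moreover have "cos (arccos x) = x" using x by (intro cos_arccos) auto
    ultimately show "x \<in> {x. poly (P - Q) x = 0}"
      using P Q by (metis (mono_tags, lifting) eq_iff_diff_eq_0 mem_Collect_eq poly_diff)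
  qed
  ultimately have "finite {0<..<1::real}" by (rule rev_finite_subset)
  thus False using infinite_Ioo[of 0 "1::real"] by simp
qed

lemma chebyshev_U_eqI:
  assumes "\<And>\<theta>. sin \<theta> \<noteq> 0 \<Longrightarrow> poly P (cos \<theta>) = sin (real (p + 1) * \<theta>) / sin \<theta>"
  shows "chebyshev_U p = P"
  unfolding chebyshev_U_def using assms chebyshev_U_unique by (intro the_equality) blast+

lemma chebyshev_U_0: "chebyshev_U 0 = 1"
  by (intro chebyshev_U_eqI) simp

lemma chebyshev_U_1: "chebyshev_U 1 = [:0, 2:]"
  by (intro chebyshev_U_eqI) (simp add: sin_double)

lemma chebyshev_U_sin_cos:
  "sin \<theta> \<noteq> 0 \<Longrightarrow> poly (chebyshev_U p) (cos \<theta>) = sin (real (p + 1) * \<theta>) / sin \<theta>"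
  and chebyshev_U_Suc_Suc:
  "chebyshev_U (Suc (Suc p)) = [:0, 2:] * chebyshev_U (Suc p) - chebyshev_U p"
proof -
  let ?S = "\<lambda>p P. \<forall>\<theta>. sin \<theta> \<noteq> 0 \<longrightarrow> poly P (cos \<theta>) = sin (real (p + 1) * \<theta>) / sin \<theta>"
  have step: "?S (Suc (Suc p)) ([:0, 2:] * Q - P)" if "?S p P" "?S (Suc p) Q" for p and P Q :: "real poly"
  proof (intro allI impI)
    fix \<theta> :: real assume "sin \<theta> \<noteq> 0"
    have a: "real (Suc (Suc p) + 1) * \<theta> = real (Suc p + 1) * \<theta> + \<theta>"
      and b: "real (p + 1) * \<theta> = real (Suc p + 1) * \<theta> - \<theta>"
      by (simp_all add: algebra_simps)
    have "sin (real (Suc (Suc p) + 1) * \<theta>) =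
        2 * cos \<theta> * sin (real (Suc p + 1) * \<theta>) - sin (real (p + 1) * \<theta>)"
      unfolding a b sin_add sin_diff by simp
    thus "poly ([:0, 2:] * Q - P) (cos \<theta>) = sin (real (Suc (Suc p) + 1) * \<theta>) / sin \<theta>"
      using that \<open>sin \<theta> \<noteq> 0\<close> by (simp add: diff_divide_distrib mult.commute)
  qed
  have U: "?S p (chebyshev_U p)" for p
  proof (induction p rule: induct_nat_012)
    case 0
    show ?case by (simp add: chebyshev_U_0)
  next
    case 1
    show ?case using chebyshev_U_1 by (simp add: sin_double)
  next
    case (ge2 p)
    have "chebyshev_U (Suc (Suc p)) = [:0, 2:] * chebyshev_U (Suc p) - chebyshev_U p"
      using step[OF ge2] by (intro chebyshev_U_eqI) blast
    thus ?case using step[OF ge2] by simp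
  qed
  show "sin \<theta> \<noteq> 0 \<Longrightarrow> poly (chebyshev_U p) (cos \<theta>) = sin (real (p + 1) * \<theta>) / sin \<theta>"
    using U by blast
  show "chebyshev_U (Suc (Suc p)) = [:0, 2:] * chebyshev_U (Suc p) - chebyshev_U p"
    using step[OF U U] by (intro chebyshev_U_eqI) blast
qed

text \<open>\<open>R_k(x)\<close> is an element of the field of formal Laurent series in \<open>y = \<surd>x\<close>; the variable
  \<^term>\<open>fls_X\<close> stands for \<open>y\<close>. Accordingly a power series \<open>F(x)\<close> is viewed in this field as
  \<open>F(y\<^sup>2)\<close>, that is \<^term>\<open>fls_compose_power (fps_to_fls F) 2\<close>.\<close>

definition chebyshev_U_at :: "nat \<Rightarrow> real fls \<Rightarrow> real fls" where
  "chebyshev_U_at p z = poly (map_poly fls_const (chebyshev_U p)) z"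

definition R_sqrt :: "nat \<Rightarrow> real fls" where
  "R_sqrt k =
     chebyshev_U_at (k - 1) (1 / (2 * fls_X)) / (fls_X * chebyshev_U_at k (1 / (2 * fls_X)))"

end

(* A permutation avoiding 132 has the form u n w with maximum n, u > w, and u, w avoiding 132; a wedge
   pattern avoiding 132 has the form tau = p m q with maximum m, p > q, and q increasing. As q is
   increasing, an occurrence of tau in u n w cannot be cut inside q by the gap between u and w, so
   u n w contains tau iff u contains tau, or w contains tau, or u contains p and w contains q. Hence
     F_tau = 1 + x (F_p F_tau + F_tau F_q - F_p F_q),
   and R_0 = 0, R_{k+1} = 1 / (1 - x R_k) satisfies the same relation, namely
     R_{a+b+1} (1 - x R_a - x R_b) = 1 - x R_a R_b,
   by shifting one unit from b to a. So F_tau = R_{|tau|} by induction on the length of tau. *)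
theory Submission
  imports Defs "HOL-Library.Sublist"
begin

section \<open>Pattern containment via subsequences\<close>

text \<open>The equivalence ranges over all ordered pairs of positions, so ties correspond to ties.
  Comparing words instead of index maps lets an occurrence be cut along \<open>@\<close>.\<close>

definition order_iso :: "nat list \<Rightarrow> nat list \<Rightarrow> bool" where
  "order_iso xs ys \<longleftrightarrow> length xs = length ys \<and>
     (\<forall>a<length ys. \<forall>b<length ys. xs ! a < xs ! b \<longleftrightarrow> ys ! a < ys ! b)"

lemma subseq_strict_mono_index:
  assumes "subseq xs ys"
  obtains i where "strict_mono_on {..<length xs} i"
    "\<And>a. a < length xs \<Longrightarrow> i a < length ys \<and> ys ! i a = xs ! a"
proof -
  have "\<exists>i. strict_mono_on {..<length xs} i \<and>
      (\<forall>a<length xs. i a < length ys \<and> ys ! i a = xs ! a)"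
    using assms
  proof (induction rule: list_emb.induct)
    case (list_emb_Nil ys)
    show ?case by (auto simp: strict_mono_on_def)
  next
    case (list_emb_Cons xs ys y)
    then obtain i where "strict_mono_on {..<length xs} i"
      "\<forall>a<length xs. i a < length ys \<and> ys ! i a = xs ! a" by blast
    then show ?case by (intro exI[of _ "Suc \<circ> i"]) (auto simp: strict_mono_on_def)
  next
    case (list_emb_Cons2 x y xs ys)
    then obtain i where "strict_mono_on {..<length xs} i"
      "\<forall>a<length xs. i a < length ys \<and> ys ! i a = xs ! a" by blast
    with list_emb_Cons2 show ?case
      by (intro exI[of _ "case_nat 0 (Suc \<circ> i)"])
        (auto simp: strict_mono_on_def less_Suc_eq_0_disj split: nat.split)
  qed
  with that show ?thesis by blast
qed

text \<open>The chosen positions form a strictly increasing list, hence a subsequence of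
  \<open>[0..<length ys]\<close>; mapping \<open>nth ys\<close> over both lists gives the
  claim.\<close>

lemma subseq_map_nth:
  fixes i :: "nat \<Rightarrow> nat"
  assumes "strict_mono_on {..<m} i" "\<And>a. a < m \<Longrightarrow> i a < length ys"
  shows "subseq (map (\<lambda>a. ys ! i a) [0..<m]) ys"
proof -
  have "sorted (map i [0..<m])"
    using assms(1) by (auto simp: sorted_iff_nth_mono strict_mono_on_def le_less)
  moreover have "distinct (map i [0..<m])"
    using strict_mono_on_imp_inj_on[OF assms(1)] by (simp add: distinct_map atLeast0LessThan)
  ultimately have "subseq (map i [0..<m]) [0..<length ys]"
    using assms(2) by (intro sorted_subset_imp_subseq) (auto simp: strict_sorted_iff)
  from subseq_map[OF this, of "nth ys"] show ?thesis by (simp add: map_nth comp_def)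
qed

lemma contains_pattern_iff_subseq:
  "contains_pattern xs \<tau> \<longleftrightarrow> (\<exists>ys. subseq ys xs \<and> order_iso ys \<tau>)"
proof
  assume "contains_pattern xs \<tau>"
  then obtain i where i: "strict_mono_on {..<length \<tau>} i" "\<forall>a<length \<tau>. i a < length xs"
    "\<forall>a<length \<tau>. \<forall>b<length \<tau>. xs ! i a < xs ! i b \<longleftrightarrow> \<tau> ! a < \<tau> ! b"
    unfolding contains_pattern_def by blast
  then have "subseq (map (\<lambda>a. xs ! i a) [0..<length \<tau>]) xs"
    by (intro subseq_map_nth) auto
  moreover have "order_iso (map (\<lambda>a. xs ! i a) [0..<length \<tau>]) \<tau>"
    using i(3) by (simp add: order_iso_def)
  ultimately show "\<exists>ys. subseq ys xs \<and> order_iso ys \<tau>" by blast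
next
  assume "\<exists>ys. subseq ys xs \<and> order_iso ys \<tau>"
  then obtain ys where ys: "subseq ys xs" "order_iso ys \<tau>" by blast
  from subseq_strict_mono_index[OF ys(1)] obtain i where
    "strict_mono_on {..<length ys} i"
    "\<And>a. a < length ys \<Longrightarrow> i a < length xs \<and> xs ! i a = ys ! a" by blast
  with ys(2) show "contains_pattern xs \<tau>"
    unfolding contains_pattern_def order_iso_def by (intro exI[of _ i]) auto
qed

lemma contains_pattern_subseq_mono:
  "contains_pattern xs \<tau> \<Longrightarrow> subseq xs ys \<Longrightarrow> contains_pattern ys \<tau>"
  unfolding contains_pattern_iff_subseq by (meson subseq_order.order_trans)

lemma contains_pattern_map_strict_mono:
  assumes "strict_mono f"
  shows "contains_pattern (map f xs) \<tau> \<longleftrightarrow> contains_pattern xs \<tau>"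
  unfolding contains_pattern_def
  by (intro ex_cong1) (auto simp: strict_mono_less[OF assms])

lemma contains_pattern_Nil [simp]: "contains_pattern xs []"
  by (simp add: contains_pattern_def strict_mono_on_def)

lemma contains_pattern_Nil_left: "contains_pattern [] \<tau> \<longleftrightarrow> \<tau> = []"
  by (auto simp: contains_pattern_def strict_mono_on_def)

lemma order_iso_append:
  assumes "length us = length xs"
  shows "order_iso (us @ vs) (xs @ ys) \<longleftrightarrow> order_iso us xs \<and> order_iso vs ys \<and>
    (\<forall>a<length xs. \<forall>b<length ys. (us ! a < vs ! b \<longleftrightarrow> xs ! a < ys ! b) \<and>
       (vs ! b < us ! a \<longleftrightarrow> ys ! b < xs ! a))"
  (is "?L \<longleftrightarrow> ?R")
proof
  assume L: ?L
  then have len: "length vs = length ys" using assms by (simp add: order_iso_def)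
  have *: "(us @ vs) ! a < (us @ vs) ! b \<longleftrightarrow> (xs @ ys) ! a < (xs @ ys) ! b"
    if "a < length xs + length ys" "b < length xs + length ys" for a b
    using L that by (simp add: order_iso_def)
  have "us ! a < us ! b \<longleftrightarrow> xs ! a < xs ! b" if "a < length xs" "b < length xs" for a b
    using *[of a b] that assms by (simp add: nth_append)
  moreover have "vs ! a < vs ! b \<longleftrightarrow> ys ! a < ys ! b" if "a < length ys" "b < length ys" for a b
    using *[of "length xs + a" "length xs + b"] that assms by (simp add: nth_append)
  moreover have "us ! a < vs ! b \<longleftrightarrow> xs ! a < ys ! b" if "a < length xs" "b < length ys" for a b
    using *[of a "length xs + b"] that assms by (simp add: nth_append)
  moreover have "vs ! b < us ! a \<longleftrightarrow> ys ! b < xs ! a" if "a < length xs" "b < length ys" for a b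
    using *[of "length xs + b" a] that assms by (simp add: nth_append)
  ultimately show ?R using len assms by (simp add: order_iso_def)
next
  assume ?R
  then show ?L using assms by (auto simp: order_iso_def nth_append)
qed

text \<open>In \<open>p @ m # q\<close> the outcome of every comparison across the three parts is
  fixed, so the index conditions of \<open>order_iso_append\<close> become inequalities between the
  letters of \<open>p'\<close>, \<open>m'\<close> and \<open>q'\<close>.\<close>

lemma order_iso_split:
  assumes "\<And>x y. x \<in> set p \<Longrightarrow> y \<in> set q \<Longrightarrow> y < x"
    and "\<And>x. x \<in> set p \<union> set q \<Longrightarrow> x < m"
    and "length p' = length p" "length q' = length q"
  shows "order_iso (p' @ m' # q') (p @ m # q) \<longleftrightarrow>
    order_iso p' p \<and> order_iso q' q \<and> (\<forall>x\<in>set p'. \<forall>y\<in>set q'. y < x) \<and>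
    (\<forall>x\<in>set p' \<union> set q'. x < m')"
proof -
  have 1: "(\<forall>a<length p. \<forall>b<length q. (p' ! a < q' ! b \<longleftrightarrow> p ! a < q ! b) \<and>
       (q' ! b < p' ! a \<longleftrightarrow> q ! b < p ! a)) \<longleftrightarrow> (\<forall>x\<in>set p'. \<forall>y\<in>set q'. y < x)"
  proof -
    have "q ! b < p ! a \<and> \<not> p ! a < q ! b" if "a < length p" "b < length q" for a b
      using assms(1)[of "p ! a" "q ! b"] that by simp
    then show ?thesis unfolding all_set_conv_all_nth assms(3,4) by (meson less_asym)
  qed
  have 2: "(\<forall>a<length p. (p' ! a < m' \<longleftrightarrow> p ! a < m) \<and> (m' < p' ! a \<longleftrightarrow> m < p ! a)) \<longleftrightarrow>
      (\<forall>x\<in>set p'. x < m')"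
  proof -
    have "p ! a < m \<and> \<not> m < p ! a" if "a < length p" for a
      using assms(2)[of "p ! a"] that by simp
    then show ?thesis unfolding all_set_conv_all_nth assms(3) by (meson less_asym)
  qed
  have 3: "(\<forall>b<length q. (m' < q' ! b \<longleftrightarrow> m < q ! b) \<and> (q' ! b < m' \<longleftrightarrow> q ! b < m)) \<longleftrightarrow>
      (\<forall>x\<in>set q'. x < m')"
  proof -
    have "q ! b < m \<and> \<not> m < q ! b" if "b < length q" for b
      using assms(2)[of "q ! b"] that by simp
    then show ?thesis unfolding all_set_conv_all_nth assms(4) by (meson less_asym)
  qed
  have "order_iso ([m'] @ q') ([m] @ q) \<longleftrightarrow> order_iso q' q \<and> (\<forall>x\<in>set q'. x < m')"
    by (subst order_iso_append) (use 3 in \<open>auto simp: order_iso_def\<close>)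
  moreover have "order_iso (p' @ m' # q') (p @ m # q) \<longleftrightarrow> order_iso p' p \<and>
      order_iso ([m'] @ q') ([m] @ q) \<and> (\<forall>x\<in>set p'. \<forall>y\<in>set q'. y < x) \<and> (\<forall>x\<in>set p'. x < m')"
    unfolding 1[symmetric] 2[symmetric]
    by (subst order_iso_append) (use assms in \<open>auto simp: All_less_Suc2\<close>)
  ultimately show ?thesis by auto
qed

section \<open>Occurrences of 132\<close>

lemma contains_132_iff:
  "contains_pattern xs [1, 3, 2] \<longleftrightarrow> (\<exists>a b c. subseq [a, c, b] xs \<and> a < b \<and> b < c)"
proof -
  have "order_iso ys [1, 3, 2] \<longleftrightarrow> (\<exists>a b c. ys = [a, c, b] \<and> a < b \<and> b < c)" for ys
  proof
    assume ys: "order_iso ys [1, 3, 2]"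
    then have "length ys = 3" by (simp add: order_iso_def)
    then obtain a c b where "ys = [a, c, b]"
      by (metis (no_types, opaque_lifting) length_0_conv length_Suc_conv numeral_3_eq_3)
    with ys show "\<exists>a b c. ys = [a, c, b] \<and> a < b \<and> b < c"
      by (auto simp: order_iso_def All_less_Suc)
  qed (auto simp: order_iso_def All_less_Suc)
  then have "contains_pattern xs [1, 3, 2] \<longleftrightarrow>
      (\<exists>ys. subseq ys xs \<and> (\<exists>a b c. ys = [a, c, b] \<and> a < b \<and> b < c))"
    by (simp only: contains_pattern_iff_subseq)
  then show ?thesis by blast
qed

text \<open>The maximum \<open>n\<close> can only stand for the 3. If it does, or if an occurrence
  meets both \<open>u\<close> and \<open>w\<close>, then the 1 lies in \<open>u\<close> and the 2 in
  \<open>w\<close>, although \<open>u\<close> lies above \<open>w\<close>.\<close>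

lemma contains_132_split:
  assumes "\<And>x y. x \<in> set u \<Longrightarrow> y \<in> set w \<Longrightarrow> y < x"
    and "\<And>x. x \<in> set u \<union> set w \<Longrightarrow> x < n"
  shows "contains_pattern (u @ n # w) [1, 3, 2] \<longleftrightarrow>
    contains_pattern u [1, 3, 2] \<or> contains_pattern w [1, 3, 2]"
proof
  assume "contains_pattern (u @ n # w) [1, 3, 2]"
  then obtain a b c where abc: "subseq [a, c, b] (u @ [n] @ w)" "a < b" "b < c"
    unfolding contains_132_iff by auto
  then obtain p q r where pqr: "[a, c, b] = p @ q @ r" "subseq p u" "subseq q [n]" "subseq r w"
    unfolding subseq_append_iff by metis
  have sub: "set p \<subseteq> set u" "set q \<subseteq> {n}" "set r \<subseteq> set w"
    using pqr(2-4) by (auto dest: list_emb_set)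
  \<comment> \<open>As \<open>q\<close> has at most one letter, the disjunction below lists every
    way to cut a, c, b into pieces from \<open>u\<close>, \<open>[n]\<close> and
    \<open>w\<close>.\<close>
  have "length q \<le> 1" using list_emb_length[OF pqr(3)] by simp
  then have "(p = [a, c, b] \<or> r = [a, c, b]) \<or> b = n \<or> (c = n \<or> c \<in> set u) \<and> a \<in> set u \<and> b \<in> set w
     \<or> a = n \<or> (a \<in> set u \<and> c \<in> set w \<and> b \<in> set w)"
    using pqr(1) sub by (auto simp: Cons_eq_append_conv)
  moreover have "a \<in> set u \<union> {n} \<union> set w" "b \<in> set u \<union> {n} \<union> set w" "c \<in> set u \<union> {n} \<union> set w"
    using list_emb_set[OF abc(1)] by auto
  ultimately have "p = [a, c, b] \<or> r = [a, c, b]"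
    using assms abc(2,3) by (smt (verit) UnE UnI1 UnI2 less_asym less_trans singletonD)
  then show "contains_pattern u [1, 3, 2] \<or> contains_pattern w [1, 3, 2]"
    using pqr abc unfolding contains_132_iff by blast
next
  assume "contains_pattern u [1, 3, 2] \<or> contains_pattern w [1, 3, 2]"
  then show "contains_pattern (u @ n # w) [1, 3, 2]"
    by (auto elim!: contains_pattern_subseq_mono)
qed

section \<open>Wedge words\<close>

text \<open>A wedge pattern that avoids 132 is peeled off at its maximum \<open>m\<close>: the increasing segment \<open>q\<close>
  after \<open>m\<close> then lies below everything before \<open>m\<close>. Values are only meant up to order isomorphism,
  which saves standardizing \<open>p\<close> after removing \<open>q\<close>; that the small entries form a layered
  permutation is automatic and plays no role.\<close>

inductive wedge_word :: "nat list \<Rightarrow> bool" where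
  Nil: "wedge_word []"
| snoc: "wedge_word p \<Longrightarrow> sorted_wrt (<) q \<Longrightarrow> (\<And>x y. x \<in> set p \<Longrightarrow> y \<in> set q \<Longrightarrow> y < x) \<Longrightarrow>
    (\<And>x. x \<in> set p \<union> set q \<Longrightarrow> x < m) \<Longrightarrow> wedge_word (p @ m # q)"

text \<open>Lets the final induction apply to the segment \<open>q\<close> as well as to
  \<open>p\<close>. The last letter of an increasing word is its maximum and is peeled off with
  nothing after it.\<close>

lemma wedge_word_strict_sorted: "sorted_wrt (<) q \<Longrightarrow> wedge_word q"
proof (induction q rule: rev_induct)
  case (snoc x xs)
  then show ?case using wedge_word.snoc[of xs "[]" x] by (simp add: sorted_wrt_append)
qed (rule wedge_word.Nil)

lemma wedge_word_append_sorted: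
  assumes "wedge_word p" "sorted_wrt (<) t" "\<And>x y. x \<in> set p \<Longrightarrow> y \<in> set t \<Longrightarrow> x < y"
  shows "wedge_word (p @ t)"
  using assms(2,3)
proof (induction t rule: rev_induct)
  case (snoc x xs)
  then have "wedge_word (p @ xs)" by (auto simp: sorted_wrt_append)
  from wedge_word.snoc[OF this, of "[]" x] snoc.prems show ?case
    by (auto simp: sorted_wrt_append)
qed (simp add: assms(1))

text \<open>Induction on the number of pairs. The last letter \<open>m\<close> of the last
  \<open>t\<close> is the overall maximum and is followed by \<open>r\<close>. A letter x before
  \<open>m\<close> and a larger y in \<open>r\<close> would make x, \<open>m\<close>, y a 132, so
  \<open>r\<close> lies below everything before \<open>m\<close>.\<close>

lemma wedge_word_decomposition:
  assumes "distinct (concat (map (\<lambda>(t, r). t @ r) ps))"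
    and "avoids_pattern (concat (map (\<lambda>(t, r). t @ r) ps)) [1, 3, 2]"
    and "\<And>t r. (t, r) \<in> set ps \<Longrightarrow> t \<noteq> [] \<and> sorted r"
    and "sorted_wrt (<) (concat (map fst ps))"
    and "\<And>x y. x \<in> set (concat (map snd ps)) \<Longrightarrow> y \<in> set (concat (map fst ps)) \<Longrightarrow> x < y"
  shows "wedge_word (concat (map (\<lambda>(t, r). t @ r) ps))"
  using assms
proof (induction ps rule: rev_induct)
  case (snoc tr ps)
  obtain t r where tr: "tr = (t, r)" by (cases tr)
  define u where "u = concat (map (\<lambda>(t, r). t @ r) ps)"
  have full: "concat (map (\<lambda>(t, r). t @ r) (ps @ [tr])) = u @ t @ r"
    by (simp add: tr u_def)
  have "subseq u (u @ t @ r)" by auto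
  with snoc.prems(2) have "avoids_pattern u [1, 3, 2]"
    unfolding full by (meson contains_pattern_subseq_mono)
  with snoc.prems have u: "wedge_word u"
    unfolding u_def by (intro snoc.IH) (auto simp: sorted_wrt_append)
  have "t \<noteq> []" and r: "sorted r" using snoc.prems(3) by (auto simp: tr)
  then obtain t' m where t: "t = t' @ [m]" by (metis rev_exhaust)
  have st: "sorted_wrt (<) t" using snoc.prems(4) by (simp add: tr sorted_wrt_append)
  have set_u: "set u = set (concat (map fst ps)) \<union> set (concat (map snd ps))"
    by (force simp: u_def)
  have ut: "x < y" if "x \<in> set u" "y \<in> set t" for x y
    using that snoc.prems(4,5) unfolding set_u by (auto simp: tr sorted_wrt_append)
  have p: "wedge_word (u @ t')"
    using u st ut by (intro wedge_word_append_sorted) (auto simp: t sorted_wrt_append)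
  have rm: "y < m" if "y \<in> set r" for y
    using snoc.prems(5)[of y m] that by (simp add: tr t)
  have pm: "x < m" if "x \<in> set (u @ t')" for x
    using ut[of x m] st that by (auto simp: t sorted_wrt_append)
  have dist: "distinct (u @ t @ r)" using snoc.prems(1) unfolding full .
  have "y < x" if x: "x \<in> set (u @ t')" and y: "y \<in> set r" for x y
  proof (rule ccontr)
    assume "\<not> y < x"
    with x y dist have "x < y" by (auto simp: t not_less le_less)
    moreover have "subseq ([x] @ [m] @ [y]) ((u @ t') @ [m] @ r)"
      using x y by (intro list_emb_append_mono) (auto simp: subseq_singleton_left)
    ultimately have "contains_pattern (u @ t @ r) [1, 3, 2]"
      using rm[OF y] unfolding contains_132_iff t by auto
    then show False using snoc.prems(2) unfolding full by simp
  qed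
  moreover have "sorted_wrt (<) r" using r dist by (simp add: strict_sorted_iff)
  ultimately have "wedge_word ((u @ t') @ m # r)"
    using p pm rm by (intro wedge_word.snoc) auto
  then show ?case unfolding full t by simp
qed (simp add: wedge_word.Nil)

lemma wedge_pattern_imp_wedge_word:
  assumes "wedge_pattern k \<tau>" "avoids_pattern \<tau> [1, 3, 2]"
  shows "wedge_word \<tau>"
proof -
  from assms(1) obtain ps s where \<tau>: "\<tau> \<in> permutations_of_set {1..k}"
    and ps: "\<tau> = concat (map (\<lambda>(t, \<rho>). t @ \<rho>) ps)" "\<forall>(t, \<rho>) \<in> set ps. t \<noteq> [] \<and> sorted \<rho>"
      "concat (map fst ps) = [s + 1 ..< k + 1]"
    unfolding wedge_pattern_def by blast
  have d: "distinct \<tau>" "set \<tau> = {1..k}"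
    using \<tau> by (auto simp: permutations_of_set_def)
  have disj: "set (concat (map snd ps)) \<inter> set (concat (map fst ps)) = {}"
    using d(1) unfolding ps(1)
  proof (induction ps)
    case (Cons a ps)
    obtain t r where a: "a = (t, r)" by (cases a)
    have "set (concat (map (\<lambda>(t, r). t @ r) ps)) =
        set (concat (map fst ps)) \<union> set (concat (map snd ps))" by force
    with Cons show ?case by (auto simp: a)
  qed simp
  have "set (concat (map snd ps)) \<subseteq> {1..k}"
    unfolding d(2)[symmetric] ps(1) by force
  \<comment> \<open>The first components use up all of \<open>s + 1\<close>, ..., \<open>k\<close>,
    so a letter of a second component is at most \<open>s\<close>.\<close>
  with disj have "x < y" if "x \<in> set (concat (map snd ps))" "y \<in> set (concat (map fst ps))" for x y
    using that unfolding ps(3) by (force simp: set_eq_iff)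
  moreover have "\<And>t \<rho>. (t, \<rho>) \<in> set ps \<Longrightarrow> t \<noteq> [] \<and> sorted \<rho>" using ps(2) by blast
  moreover have "sorted_wrt (<) (concat (map fst ps))" unfolding ps(3) by (rule sorted_wrt_upt)
  ultimately show ?thesis
    using d(1) assms(2) unfolding ps(1) by (intro wedge_word_decomposition)
qed

section \<open>Cutting an occurrence of the pattern at the maximum of the permutation\<close>

lemma contains_split:
  assumes "sorted_wrt (<) q" "\<And>x y. x \<in> set p \<Longrightarrow> y \<in> set q \<Longrightarrow> y < x"
    and "\<And>x. x \<in> set p \<union> set q \<Longrightarrow> x < m"
    and uw: "\<And>x y. x \<in> set u \<Longrightarrow> y \<in> set w \<Longrightarrow> y < x"
    and un: "\<And>x. x \<in> set u \<union> set w \<Longrightarrow> x < n"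
  shows "contains_pattern (u @ n # w) (p @ m # q) \<longleftrightarrow>
    contains_pattern u p \<and> contains_pattern w q \<or>
    contains_pattern u (p @ m # q) \<or> contains_pattern w (p @ m # q)" (is "?L \<longleftrightarrow> ?R")
proof
  assume ?L
  then obtain ys where ys: "subseq ys (u @ [n] @ w)" "order_iso ys (p @ m # q)"
    unfolding contains_pattern_iff_subseq by auto
  define p' m' q' where "p' = take (length p) ys" and "m' = ys ! length p"
    and "q' = drop (Suc (length p)) ys"
  have len: "length ys = length p + Suc (length q)" using ys(2) by (simp add: order_iso_def)
  then have split: "ys = p' @ m' # q'"
    by (simp add: p'_def m'_def q'_def id_take_nth_drop)
  have len': "length p' = length p" "length q' = length q"
    using len by (auto simp: p'_def q'_def)
  have "order_iso (p' @ m' # q') (p @ m # q) \<longleftrightarrow>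
    order_iso p' p \<and> order_iso q' q \<and> (\<forall>x\<in>set p'. \<forall>y\<in>set q'. y < x) \<and>
    (\<forall>x\<in>set p' \<union> set q'. x < m')"
    by (rule order_iso_split) (use assms(2,3) len' in auto)
  with ys(2) have iso: "order_iso p' p" "order_iso q' q"
      "\<And>x y. x \<in> set p' \<Longrightarrow> y \<in> set q' \<Longrightarrow> y < x" "\<And>x. x \<in> set p' \<union> set q' \<Longrightarrow> x < m'"
    unfolding split by auto
  have sq: "sorted_wrt (<) q'"
    using iso(2) assms(1) by (auto simp: order_iso_def sorted_wrt_iff_nth_less)
  from ys(1) obtain a b c where abc: "ys = a @ b @ c" "subseq a u" "subseq b [n]" "subseq c w"
    unfolding subseq_append_iff by metis
  have sub: "set a \<subseteq> set u" "set c \<subseteq> set w"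
    using abc by (auto dest: list_emb_set)
  have b: "b = [] \<or> b = [n]"
    using abc(3) by (cases b) (auto split: if_splits)
  show ?R
  proof (cases "b = [n]")
    case True
    \<comment> \<open>\<open>m'\<close> is the largest letter of the occurrence, and no letter
      exceeds \<open>n\<close>.\<close>
    have "m' = n"
    proof -
      have "n \<in> set ys" using abc(1) True by simp
      then have "n \<le> m'" using iso(4) by (auto simp: split intro: less_imp_le)
      moreover have "m' \<in> set u \<union> {n} \<union> set w" 
      proof -
        have "m' \<in> set ys" by (simp add: split)
        then show ?thesis using abc(1) sub True by auto
      qed
      ultimately show ?thesis using un by fastforce
    qed
    moreover have "n \<notin> set a" "n \<notin> set c" "n \<notin> set p'" "n \<notin> set q'"
      using un sub iso(4) calculation by blast+
    ultimately have "p' = a" "q' = c"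
      using abc(1) True unfolding split by (auto simp: append_Cons_eq_iff)
    then show ?thesis using iso abc unfolding contains_pattern_iff_subseq by blast
  next
    case False
    with b abc(1) have ac: "p' @ m' # q' = a @ c" by (simp add: split)
    consider "a = []" | "c = []" | "a \<noteq> []" "c \<noteq> []" by blast
    then show ?thesis
    proof cases
      case 1
      then show ?thesis using ac abc ys(2) split unfolding contains_pattern_iff_subseq by auto
    next
      case 2
      then show ?thesis using ac abc ys(2) split unfolding contains_pattern_iff_subseq by auto
    next
      case 3
      have ca: "y < x" if "x \<in> set a" "y \<in> set c" for x y
        using that sub uw by blast
      \<comment> \<open>The gap between \<open>u\<close> and \<open>w\<close> falls either after
        \<open>m'\<close>, with \<open>d\<close> the part of \<open>q'\<close> left in
        \<open>u\<close>, or before \<open>m'\<close>, with \<open>d\<close> the part of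
        \<open>p'\<close> moved to \<open>w\<close>.\<close>
      from ac consider d where "p' @ [m'] @ d = a" "q' = d @ c"
        | d where "p' = a @ d" "c = d @ m' # q'"
        by (auto simp: append_eq_append_conv2 Cons_eq_append_conv)
      then show ?thesis
      proof cases
        case (1 d)
        \<comment> \<open>Otherwise a letter of \<open>q'\<close> in \<open>u\<close> would be
          followed by a larger one in \<open>w\<close>.\<close>
        have "d = []"
        proof (rule ccontr)
          assume "d \<noteq> []"
          with sq 1(2) 3(2) have "hd d < hd c" by (simp add: sorted_wrt_append)
          moreover have "hd c < hd d" using ca[of "hd d" "hd c"] 1(1) \<open>d \<noteq> []\<close> 3(2) by auto
          ultimately show False by simp
        qed
        with 1 have "subseq p' u" "subseq q' w"
          using abc(2,4) by (auto intro: subseq_order.order_trans[of p' a u])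
        then show ?thesis using iso unfolding contains_pattern_iff_subseq by blast
      next
        case (2 d)
        \<comment> \<open>Here \<open>m'\<close> lies in \<open>w\<close>, so the first letter of
          \<open>p'\<close>, which lies in \<open>u\<close>, would be both below and above
          it.\<close>
        have "hd a < m'" using iso(4)[of "hd a"] 2(1) 3(1) by simp
        moreover have "m' < hd a" using ca[of "hd a" m'] 2 3(1) by simp
        ultimately show ?thesis by simp
      qed
    qed
  qed
next
  assume ?R
  moreover have "subseq u (u @ n # w)" "subseq w (u @ n # w)" by auto
  moreover have ?L if "contains_pattern u p" "contains_pattern w q"
  proof -
    from that obtain p' q' where *: "subseq p' u" "order_iso p' p" "subseq q' w" "order_iso q' q"
      unfolding contains_pattern_iff_subseq by blast
    then have sub: "subseq (p' @ n # q') (u @ n # w)" by (intro list_emb_append_mono) auto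
    have "set p' \<subseteq> set u" "set q' \<subseteq> set w" using * by (auto dest: list_emb_set)
    moreover have "order_iso (p' @ n # q') (p @ m # q) \<longleftrightarrow>
        order_iso p' p \<and> order_iso q' q \<and> (\<forall>x\<in>set p'. \<forall>y\<in>set q'. y < x) \<and>
        (\<forall>x\<in>set p' \<union> set q'. x < n)"
      by (rule order_iso_split) (use assms(2,3) * in \<open>auto simp: order_iso_def\<close>)
    ultimately have "order_iso (p' @ n # q') (p @ m # q)"
      using * uw un by blast
    with sub show ?L unfolding contains_pattern_iff_subseq by blast
  qed
  ultimately show ?L by (meson contains_pattern_subseq_mono)
qed

section \<open>The recurrence for the generating function\<close>

lemma contains_pattern_appendD:
  assumes "contains_pattern xs (p @ q)"
  shows "contains_pattern xs p" "contains_pattern xs q"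
proof -
  obtain ys where ys: "subseq ys xs" "order_iso ys (p @ q)"
    using assms unfolding contains_pattern_iff_subseq by blast
  define u v where "u = take (length p) ys" and "v = drop (length p) ys"
  have uv: "ys = u @ v" "length u = length p"
    using ys(2) by (auto simp: u_def v_def order_iso_def)
  then have "order_iso u p" "order_iso v q"
    using ys(2) order_iso_append[of u p v q] by auto
  moreover have "subseq u xs" "subseq v xs"
    using ys(1) uv(1) by (auto intro: subseq_order.order_trans)
  ultimately show "contains_pattern xs p" "contains_pattern xs q"
    unfolding contains_pattern_iff_subseq by blast+
qed

section \<open>Decomposition of the 132-avoiding permutations at their maximum\<close>

definition avoiders_132 :: "nat \<Rightarrow> nat list set" where
  "avoiders_132 n = {\<alpha> \<in> permutations_of_set {1..n}. avoids_pattern \<alpha> [1, 3, 2]}"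

lemma avoiders_132_iff:
  "\<alpha> \<in> avoiders_132 n \<longleftrightarrow> distinct \<alpha> \<and> set \<alpha> = {1..n} \<and> avoids_pattern \<alpha> [1, 3, 2]"
  by (auto simp: avoiders_132_def permutations_of_set_def)

lemma finite_avoiders_132 [simp]: "finite (avoiders_132 n)"
  by (simp add: avoiders_132_def)

lemma avoid_count_eq: "avoid_count \<tau> n = card {\<alpha> \<in> avoiders_132 n. avoids_pattern \<alpha> \<tau>}"
  unfolding avoid_count_def avoiders_132_def by (rule arg_cong[where f = card]) auto

text \<open>With \<open>Suc n\<close> as the 3, avoiding 132 forces all letters before it above all
  letters after it. The latter are therefore \<open>{1..i}\<close>, and the former become a
  permutation after a shift by \<open>i\<close>.\<close>

lemma avoiders_132_Suc_split:
  assumes "\<alpha> \<in> avoiders_132 (Suc n)"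
  obtains i \<beta> \<gamma> where "i \<le> n" "\<beta> \<in> avoiders_132 (n - i)" "\<gamma> \<in> avoiders_132 i"
    "\<alpha> = map ((+) i) \<beta> @ Suc n # \<gamma>"
proof -
  have \<alpha>: "distinct \<alpha>" "set \<alpha> = {1..Suc n}" "avoids_pattern \<alpha> [1, 3, 2]"
    using assms by (auto simp: avoiders_132_iff)
  then obtain u w where uw: "\<alpha> = u @ Suc n # w"
    by (metis atLeastAtMost_iff in_set_conv_decomp le_refl le_add1 plus_1_eq_Suc)
  have dist: "distinct u" "distinct w" "set u \<inter> set w = {}" "Suc n \<notin> set u \<union> set w"
    using \<alpha>(1) unfolding uw by auto
  have un: "set u \<union> set w = {1..n}"
  proof -
    have "set u \<union> set w = set \<alpha> - {Suc n}" using dist(4) unfolding uw by auto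
    moreover have "{1..Suc n} - {Suc n} = {1..n}" by auto
    ultimately show ?thesis unfolding \<alpha>(2) by (rule trans)
  qed
  have less: "y < x" if x: "x \<in> set u" and y: "y \<in> set w" for x y
  proof (rule ccontr)
    assume "\<not> y < x"
    moreover have "x \<noteq> y" using x y dist(3) by blast
    ultimately have "x < y" by simp
    moreover have "y \<in> {1..n}" using y un by blast
    then have "y < Suc n" by simp
    moreover have "subseq ([x] @ [Suc n] @ [y]) (u @ [Suc n] @ w)"
      using x y by (intro list_emb_append_mono) (auto simp: subseq_singleton_left)
    ultimately have "contains_pattern \<alpha> [1, 3, 2]"
      unfolding contains_132_iff uw by auto
    then show False using \<alpha>(3) by simp
  qed
  define i where "i = length w"
  have wi: "set w = {1..i}"
  proof -
    \<comment> \<open>A value below some letter of \<open>w\<close> cannot lie in \<open>u\<close>,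
      so the set of letters of \<open>w\<close> is an initial segment.\<close>
    have down: "x \<in> set w" if "x \<le> y" "1 \<le> x" "y \<in> set w" for x y
    proof -
      have "y \<in> {1..n}" using that(3) un by blast
      then have "x \<in> {1..n}" using that by simp
      then have "x \<in> set u \<or> x \<in> set w" using un by blast
      then show ?thesis using less[of x y] that by (meson leD)
    qed
    have "\<exists>j. set w = {1..j}"
    proof (cases "w = []")
      case False
      then have "Max (set w) \<in> set w" by simp
      then have "x \<in> set w" if "x \<in> {1..Max (set w)}" for x
        using down[of x "Max (set w)"] that by simp
      moreover have "x \<in> {1..Max (set w)}" if "x \<in> set w" for x
      proof -
        have "x \<in> {1..n}" using un that by blast
        then show ?thesis using that by simp
      qed
      ultimately have "set w = {1..Max (set w)}" by blast
      then show ?thesis by blast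
    qed (auto intro: exI[of _ 0])
    then obtain j where "set w = {1..j}" by blast
    moreover from this have "j = i" using distinct_card[OF dist(2)] by (simp add: i_def)
    ultimately show ?thesis by simp
  qed
  have "length u + length w = n"
    using distinct_card[OF \<alpha>(1)] unfolding \<alpha>(2) by (simp add: uw)
  then have "i \<le> n" by (simp add: i_def)
  have ui: "set u = {i+1..n}"
  proof -
    have "set u = {1..n} - {1..i}" using un dist(3) unfolding wi[symmetric] by blast
    moreover have "{1..n} - {1..i} = {i+1..n}" by auto
    ultimately show ?thesis by (rule trans)
  qed
  \<comment> \<open>The truncated subtraction is exact, since every letter of \<open>u\<close>
    exceeds \<open>i\<close>.\<close>
  define \<beta> where "\<beta> = map (\<lambda>x. x - i) u"
  have u: "u = map ((+) i) \<beta>"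
    unfolding \<beta>_def map_map by (rule map_idI[symmetric]) (auto simp: ui)
  have set\<beta>: "set \<beta> = {1..n-i}"
  proof -
    have "(+) i ` set \<beta> = (+) i ` {1..n-i}"
      using ui \<open>i \<le> n\<close> unfolding u by (simp add: add.commute)
    then show ?thesis by (rule inj_image_eq_iff[THEN iffD1, rotated]) simp
  qed
  have "strict_mono ((+) i)" by (simp add: strict_mono_def)
  moreover have "subseq u \<alpha>" "subseq w \<alpha>" unfolding uw by auto
  then have "avoids_pattern u [1, 3, 2]" "avoids_pattern w [1, 3, 2]"
    using \<alpha>(3) contains_pattern_subseq_mono by blast+
  ultimately have "\<beta> \<in> avoiders_132 (n - i)" "w \<in> avoiders_132 i"
    using dist set\<beta> wi unfolding u avoiders_132_iff
    by (auto simp: contains_pattern_map_strict_mono distinct_map)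
  with that \<open>i \<le> n\<close> show ?thesis by (simp add: uw u)
qed

lemma avoiders_132_parts:
  assumes "i \<le> n" "\<beta> \<in> avoiders_132 (n - i)" "\<gamma> \<in> avoiders_132 i"
  shows "\<And>x y. x \<in> set (map ((+) i) \<beta>) \<Longrightarrow> y \<in> set \<gamma> \<Longrightarrow> y < x"
    and "\<And>x. x \<in> set (map ((+) i) \<beta>) \<union> set \<gamma> \<Longrightarrow> x < Suc n"
proof -
  have "set \<beta> = {1..n-i}" "set \<gamma> = {1..i}"
    using assms by (simp_all add: avoiders_132_iff)
  then show "\<And>x y. x \<in> set (map ((+) i) \<beta>) \<Longrightarrow> y \<in> set \<gamma> \<Longrightarrow> y < x"
    and "\<And>x. x \<in> set (map ((+) i) \<beta>) \<union> set \<gamma> \<Longrightarrow> x < Suc n"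
    using assms(1) by auto
qed

lemma avoiders_132_join:
  assumes "i \<le> n" "\<beta> \<in> avoiders_132 (n - i)" "\<gamma> \<in> avoiders_132 i"
  shows "map ((+) i) \<beta> @ Suc n # \<gamma> \<in> avoiders_132 (Suc n)"
proof -
  note parts = avoiders_132_parts[OF assms]
  have \<beta>: "distinct \<beta>" "set \<beta> = {1..n-i}" "avoids_pattern \<beta> [1, 3, 2]"
    and \<gamma>: "distinct \<gamma>" "set \<gamma> = {1..i}" "avoids_pattern \<gamma> [1, 3, 2]"
    using assms by (auto simp: avoiders_132_iff)
  have "contains_pattern (map ((+) i) \<beta> @ Suc n # \<gamma>) [1, 3, 2] \<longleftrightarrow>
    contains_pattern (map ((+) i) \<beta>) [1, 3, 2] \<or> contains_pattern \<gamma> [1, 3, 2]"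
    by (rule contains_132_split) (use parts in auto)
  also have "\<dots> \<longleftrightarrow> contains_pattern \<beta> [1, 3, 2] \<or> contains_pattern \<gamma> [1, 3, 2]"
    by (simp add: contains_pattern_map_strict_mono strict_mono_def)
  finally have "avoids_pattern (map ((+) i) \<beta> @ Suc n # \<gamma>) [1, 3, 2]"
    using \<beta> \<gamma> by simp
  moreover have "(+) i ` {1..n-i} = {i+1..n}"
    using assms(1) by (simp add: add.commute)
  then have "set (map ((+) i) \<beta> @ Suc n # \<gamma>) = {1..Suc n}"
    using \<beta>(2) \<gamma>(2) assms(1) by auto
  moreover have "distinct (map ((+) i) \<beta> @ Suc n # \<gamma>)"
    using \<beta> \<gamma> assms(1) by (auto simp: distinct_map)
  ultimately show ?thesis unfolding avoiders_132_iff by blast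
qed

text \<open>For injectivity: \<open>Suc n\<close> occurs only once and so marks the cut,
  \<open>i\<close> is the length of the part after it, and the shift by \<open>i\<close> is
  injective.\<close>

lemma avoiders_132_Suc_bij:
  "bij_betw (\<lambda>(i, \<beta>, \<gamma>). map ((+) i) \<beta> @ Suc n # \<gamma>)
     (SIGMA i:{..n}. avoiders_132 (n - i) \<times> avoiders_132 i) (avoiders_132 (Suc n))"
  (is "bij_betw ?f ?S _")
proof (rule bij_betw_imageI)
  have "i = i' \<and> \<beta> = \<beta>' \<and> \<gamma> = \<gamma>'"
    if "i \<le> n" "\<beta> \<in> avoiders_132 (n - i)" "\<gamma> \<in> avoiders_132 i"
      "i' \<le> n" "\<beta>' \<in> avoiders_132 (n - i')" "\<gamma>' \<in> avoiders_132 i'"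
      "map ((+) i) \<beta> @ Suc n # \<gamma> = map ((+) i') \<beta>' @ Suc n # \<gamma>'"
    for i \<beta> \<gamma> i' \<beta>' \<gamma>'
  proof -
    have "Suc n \<notin> set (map ((+) i) \<beta>) \<union> set \<gamma>" "Suc n \<notin> set (map ((+) i') \<beta>') \<union> set \<gamma>'"
      using avoiders_132_parts(2)[of i n \<beta> \<gamma> "Suc n"] avoiders_132_parts(2)[of i' n \<beta>' \<gamma>' "Suc n"] that
      by blast+
    then have *: "map ((+) i) \<beta> = map ((+) i') \<beta>'" "\<gamma> = \<gamma>'"
      using that(7) append_Cons_eq_iff[of "Suc n" "map ((+) i) \<beta>" \<gamma>] by blast+
    have "length \<gamma> = i" "length \<gamma>' = i'"
      using that(3,6) distinct_card[of \<gamma>] distinct_card[of \<gamma>'] by (auto simp: avoiders_132_iff)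
    with * show ?thesis by (auto dest: map_injective simp: inj_def)
  qed
  then show "inj_on ?f ?S" by (auto intro!: inj_onI)
  show "?f ` ?S = avoiders_132 (Suc n)"
  proof
    show "?f ` ?S \<subseteq> avoiders_132 (Suc n)" by (auto intro: avoiders_132_join)
    show "avoiders_132 (Suc n) \<subseteq> ?f ` ?S"
    proof
      fix \<alpha> assume "\<alpha> \<in> avoiders_132 (Suc n)"
      then obtain i \<beta> \<gamma> where "i \<le> n" "\<beta> \<in> avoiders_132 (n - i)" "\<gamma> \<in> avoiders_132 i"
        "\<alpha> = map ((+) i) \<beta> @ Suc n # \<gamma>" by (rule avoiders_132_Suc_split)
      then show "\<alpha> \<in> ?f ` ?S" by (intro image_eqI[of _ _ "(i, \<beta>, \<gamma>)"]) auto
    qed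
  qed
qed

text \<open>Inclusion-exclusion over the pairs of parts: the two ways to avoid the pattern overlap
  where the left part avoids \<open>p\<close> and the right part avoids \<open>q\<close>. The
  overlap stands on the left to keep subtraction out of the natural numbers.\<close>

lemma avoid_count_Suc:
  assumes "sorted_wrt (<) q" "\<And>x y. x \<in> set p \<Longrightarrow> y \<in> set q \<Longrightarrow> y < x"
    and "\<And>x. x \<in> set p \<union> set q \<Longrightarrow> x < m" and \<tau>: "\<tau> = p @ m # q"
  shows "avoid_count \<tau> (Suc n) + (\<Sum>i\<le>n. avoid_count q i * avoid_count p (n - i)) =
    (\<Sum>i\<le>n. avoid_count \<tau> i * avoid_count p (n - i)) +
    (\<Sum>i\<le>n. avoid_count q i * avoid_count \<tau> (n - i))"
proof -
  define A where "A \<sigma> j = {\<alpha> \<in> avoiders_132 j. avoids_pattern \<alpha> \<sigma>}" for \<sigma> j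
  have fin [simp]: "finite (A \<sigma> j)" for \<sigma> j by (simp add: A_def)
  have count: "avoid_count \<sigma> j = card (A \<sigma> j)" for \<sigma> j by (simp add: A_def avoid_count_eq)
  have p\<tau>: "A p j \<subseteq> A \<tau> j" and q\<tau>: "A q j \<subseteq> A \<tau> j" for j
    using contains_pattern_appendD[of _ p "m # q"] contains_pattern_appendD[of _ "p @ [m]" q]
    by (auto simp: A_def \<tau>)
  \<comment> \<open>Negating \<open>contains_split\<close> requires both parts to avoid
    \<open>\<tau>\<close>, and the left to avoid \<open>p\<close> or the right to avoid
    \<open>q\<close>. By \<open>p\<tau>\<close> and \<open>q\<tau>\<close> one of the two demands on
    that part is absorbed.\<close>
  have iff: "avoids_pattern (map ((+) i) \<beta> @ Suc n # \<gamma>) \<tau> \<longleftrightarrow>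
      (\<beta>, \<gamma>) \<in> A p (n - i) \<times> A \<tau> i \<union> A \<tau> (n - i) \<times> A q i"
    if "i \<le> n" and \<beta>: "\<beta> \<in> avoiders_132 (n - i)" and \<gamma>: "\<gamma> \<in> avoiders_132 i" for i \<beta> \<gamma>
  proof -
    note parts = avoiders_132_parts[OF that]
    have "contains_pattern (map ((+) i) \<beta> @ Suc n # \<gamma>) (p @ m # q) \<longleftrightarrow>
      contains_pattern (map ((+) i) \<beta>) p \<and> contains_pattern \<gamma> q \<or>
      contains_pattern (map ((+) i) \<beta>) (p @ m # q) \<or> contains_pattern \<gamma> (p @ m # q)"
      by (rule contains_split) (use assms(1-3) parts in auto)
    also have "\<dots> \<longleftrightarrow> contains_pattern \<beta> p \<and> contains_pattern \<gamma> q \<or>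
        contains_pattern \<beta> \<tau> \<or> contains_pattern \<gamma> \<tau>"
      by (simp add: contains_pattern_map_strict_mono strict_mono_def \<tau>)
    finally show ?thesis
      using that p\<tau>[of "n - i"] q\<tau>[of i] unfolding A_def \<tau> by blast
  qed
  have card_pairs: "card (A p (n - i) \<times> A \<tau> i \<union> A \<tau> (n - i) \<times> A q i) +
      card (A q i) * card (A p (n - i)) =
      card (A \<tau> i) * card (A p (n - i)) + card (A q i) * card (A \<tau> (n - i))" for i
  proof -
    have "A p (n - i) \<times> A \<tau> i \<inter> A \<tau> (n - i) \<times> A q i = A p (n - i) \<times> A q i"
      using p\<tau>[of "n - i"] q\<tau>[of i] by auto
    then show ?thesis
      using card_Un_Int[of "A p (n - i) \<times> A \<tau> i" "A \<tau> (n - i) \<times> A q i"]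
      by (simp add: card_cartesian_product mult.commute)
  qed
  have "avoid_count \<tau> (Suc n) =
      card (SIGMA i:{..n}. A p (n - i) \<times> A \<tau> i \<union> A \<tau> (n - i) \<times> A q i)"
  proof -
    let ?f = "\<lambda>(i, \<beta>, \<gamma>). map ((+) i) \<beta> @ Suc n # \<gamma>"
    let ?S = "SIGMA i:{..n}. avoiders_132 (n - i) \<times> avoiders_132 i"
    let ?P = "\<lambda>(i, \<beta>, \<gamma>). (\<beta>, \<gamma>) \<in> A p (n - i) \<times> A \<tau> i \<union> A \<tau> (n - i) \<times> A q i"
    have "bij_betw ?f {x \<in> ?S. ?P x} {\<alpha> \<in> avoiders_132 (Suc n). avoids_pattern \<alpha> \<tau>}"
      by (rule bij_betw_Collect[OF avoiders_132_Suc_bij]) (use iff in auto)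
    then have "card {x \<in> ?S. ?P x} = avoid_count \<tau> (Suc n)"
      unfolding avoid_count_eq by (rule bij_betw_same_card)
    moreover have "{x \<in> ?S. ?P x} = (SIGMA i:{..n}. A p (n - i) \<times> A \<tau> i \<union> A \<tau> (n - i) \<times> A q i)"
      by (auto simp: A_def)
    ultimately show ?thesis by simp
  qed
  also have "\<dots> = (\<Sum>i\<le>n. card (A p (n - i) \<times> A \<tau> i \<union> A \<tau> (n - i) \<times> A q i))"
    by (rule card_SigmaI) auto
  finally show ?thesis
    unfolding count by (simp add: sum.distrib[symmetric] card_pairs)
qed

section \<open>From counts to power series\<close>

lemma avoid_gf_nth: "avoid_gf \<tau> $ n = real (avoid_count \<tau> n)"
  by (simp add: avoid_gf_def)

lemma avoid_gf_Nil: "avoid_gf [] = 0"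
  by (rule fps_ext) (simp add: avoid_gf_nth avoid_count_def)

lemma avoid_gf_snoc:
  assumes "sorted_wrt (<) q" "\<And>x y. x \<in> set p \<Longrightarrow> y \<in> set q \<Longrightarrow> y < x"
    and "\<And>x. x \<in> set p \<union> set q \<Longrightarrow> x < m" and \<tau>: "\<tau> = p @ m # q"
  shows "avoid_gf \<tau> * (1 - fps_X * avoid_gf p - fps_X * avoid_gf q) =
    1 - fps_X * avoid_gf p * avoid_gf q"
proof -
  have "avoid_gf \<tau> + fps_X * (avoid_gf q * avoid_gf p) =
      1 + fps_X * (avoid_gf \<tau> * avoid_gf p + avoid_gf q * avoid_gf \<tau>)" (is "?l = ?r")
  proof (rule fps_ext)
    fix n
    show "?l $ n = ?r $ n"
    proof (cases n)
      case 0
      \<comment> \<open>The constant term comes from the empty permutation, which avoids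
        \<open>\<tau>\<close> because \<open>\<tau>\<close> contains \<open>m\<close>.\<close>
      have "avoid_count \<tau> 0 = 1"
        by (simp add: avoid_count_def contains_pattern_Nil_left \<tau> Collect_conv_if)
      with 0 show ?thesis by (simp add: avoid_gf_nth)
    next
      case (Suc j)
      have "real (avoid_count \<tau> (Suc j) + (\<Sum>i\<le>j. avoid_count q i * avoid_count p (j - i))) =
          real ((\<Sum>i\<le>j. avoid_count \<tau> i * avoid_count p (j - i)) +
            (\<Sum>i\<le>j. avoid_count q i * avoid_count \<tau> (j - i)))"
        using avoid_count_Suc[of q p m \<tau> j] assms by presburger
      moreover have X: "(fps_X * f) $ Suc j = f $ j" for f :: "real fps" by simp
      ultimately show ?thesis
        unfolding Suc fps_add_nth X by (simp add: avoid_gf_nth fps_mult_nth atLeast0AtMost)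
    qed
  qed
  then show ?thesis by (simp add: algebra_simps)
qed

section \<open>The continued fraction\<close>

text \<open>This is R_k as a power series in x itself, free of square roots. The value at 0 reflects
  U_{-1} = 0 and agrees with \<open>avoid_gf_Nil\<close>.\<close>

fun cheb_fraction :: "nat \<Rightarrow> real fps" where
  "cheb_fraction 0 = 0"
| "cheb_fraction (Suc k) = inverse (1 - fps_X * cheb_fraction k)"

lemma cheb_fraction_Suc_mult: "cheb_fraction (Suc k) * (1 - fps_X * cheb_fraction k) = 1"
  by (simp add: inverse_mult_eq_1)

declare cheb_fraction.simps(2) [simp del]

text \<open>The index \<open>Suc (a + b)\<close> depends only on the sum, so induction on
  \<open>b\<close> with \<open>a\<close> arbitrary moves one unit at a time from \<open>b\<close> to
  \<open>a\<close>.\<close>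

lemma cheb_fraction_add:
  "cheb_fraction (Suc (a + b)) * (1 - fps_X * cheb_fraction a - fps_X * cheb_fraction b) =
    1 - fps_X * cheb_fraction a * cheb_fraction b"
proof (induction b arbitrary: a)
  case 0
  show ?case using cheb_fraction_Suc_mult[of a] by simp
next
  case (Suc b)
  define R A A' B B' where "R = cheb_fraction (Suc (a + Suc b))" and "A = cheb_fraction a"
    and "A' = cheb_fraction (Suc a)" and "B = cheb_fraction b" and "B' = cheb_fraction (Suc b)"
  let ?X = "fps_X :: real fps"
  have IH: "R * (1 - ?X * A' - ?X * B) = 1 - ?X * A' * B"
    using Suc.IH[of "Suc a"] by (simp add: R_def A'_def B_def)
  have A': "A' * (1 - ?X * A) = 1" and B': "B' * (1 - ?X * B) = 1"
    using cheb_fraction_Suc_mult by (auto simp: A_def A'_def B_def B'_def)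
  \<comment> \<open>Multiplying \<open>IH\<close> by 1 - xA and the goal by 1 - xB turns both into
    R((1 - xA)(1 - xB) - x) = 1 - xA - xB, and 1 - xB is invertible by \<open>B'\<close>.\<close>
  have "R * (1 - ?X * A - ?X * B') = 1 - ?X * A * B'"
    using IH A' B' by algebra
  then show ?case by (simp add: R_def A_def B'_def)
qed

lemma avoid_gf_wedge_word: "wedge_word \<tau> \<Longrightarrow> avoid_gf \<tau> = cheb_fraction (length \<tau>)"
proof (induction "length \<tau>" arbitrary: \<tau> rule: less_induct)
  case less
  from less.prems show ?case
  proof cases
    case Nil
    then show ?thesis by (simp add: avoid_gf_Nil)
  next
    case (snoc p q m)
    let ?D = "1 - fps_X * avoid_gf p - fps_X * avoid_gf q"
    have p: "avoid_gf p = cheb_fraction (length p)" and q: "avoid_gf q = cheb_fraction (length q)"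
      using less.hyps snoc wedge_word_strict_sorted[of q] by auto
    have "avoid_gf \<tau> * ?D = 1 - fps_X * avoid_gf p * avoid_gf q"
      by (rule avoid_gf_snoc) (use snoc in auto)
    also have "\<dots> = cheb_fraction (Suc (length p + length q)) * ?D"
      unfolding p q by (rule cheb_fraction_add[symmetric])
    finally have "avoid_gf \<tau> * ?D = cheb_fraction (length \<tau>) * ?D"
      by (simp add: snoc(1))
    \<comment> \<open>The constant term shows that \<open>?D\<close> is nonzero, so it can be
      cancelled.\<close>
    moreover have "?D $ 0 = 1" by simp
    then have "?D \<noteq> 0" by force
    ultimately show ?thesis by simp
  qed
qed

section \<open>Chebyshev polynomials at \<open>1 / (2 y)\<close>\<close>

lemma map_poly_fls_const_diff:
  "map_poly fls_const (p - q) = map_poly fls_const p - map_poly fls_const (q :: real poly)"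
  by (rule poly_eqI) (simp add: coeff_map_poly fls_minus_const)

lemma chebyshev_U_at_0: "chebyshev_U_at 0 z = 1"
  by (simp add: chebyshev_U_at_def chebyshev_U_0)

lemma chebyshev_U_at_1: "chebyshev_U_at (Suc 0) z = 2 * z"
proof -
  have "fls_const (2 :: real) = 2" by (simp add: fls_const_numeral)
  then show ?thesis
    using chebyshev_U_1 by (simp add: chebyshev_U_at_def map_poly_pCons mult.commute)
qed

lemma chebyshev_U_at_Suc_Suc:
  "chebyshev_U_at (Suc (Suc p)) z = 2 * z * chebyshev_U_at (Suc p) z - chebyshev_U_at p z"
proof -
  have "[:0, 2:] * chebyshev_U (Suc p) = pCons 0 (smult 2 (chebyshev_U (Suc p)))" by simp
  moreover have "fls_const (2 :: real) = 2" by (simp add: fls_const_numeral)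
  ultimately show ?thesis
    by (simp add: chebyshev_U_at_def chebyshev_U_Suc_Suc map_poly_fls_const_diff map_poly_pCons
        map_poly_smult mult_ac)
qed

text \<open>At z = 1/(2y) the three-term recurrence times y reads y U_{k+2} = U_{k+1} - y U_k, which
  is the continued fraction step for U_k / (y U_{k+1}) with x = y^2. Nonvanishing is carried along
  because the final quotient needs a nonzero denominator.\<close>

lemma fls_compose_power_cheb_fraction:
  defines "C \<equiv> (\<lambda>F. fls_compose_power (fps_to_fls F) 2 :: real fls)"
    and "u \<equiv> (\<lambda>k. chebyshev_U_at k (1 / (2 * fls_X)))"
  shows "u k \<noteq> 0 \<and> u k = fls_X * u (Suc k) * C (cheb_fraction (Suc k))"
proof -
  have "y * (2 * (1 / (2 * y))) = 1" if "y \<noteq> 0" for y :: "real fls"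
    using that by (simp add: field_simps)
  from this[OF fls_X_nonzero] have yz: "fls_X * (2 * (1 / (2 * fls_X))) = (1 :: real fls)" .
  show ?thesis
  proof (induction k)
    case 0
    have "cheb_fraction (Suc 0) = 1" using cheb_fraction_Suc_mult[of 0] by simp
    then show ?case
      unfolding u_def C_def chebyshev_U_at_0 chebyshev_U_at_1 yz by simp
  next
    case (Suc k)
    \<comment> \<open>By the induction hypothesis it is a factor of the nonzero
      \<open>u k\<close>.\<close>
    then have "u (Suc k) \<noteq> 0" by auto
    have "fls_X * (w * a - b) = fls_X * w * a - fls_X * b" for w a b :: "real fls"
      by (simp add: algebra_simps)
    then have rec: "fls_X * u (Suc (Suc k)) = u (Suc k) - fls_X * u k"
      unfolding u_def chebyshev_U_at_Suc_Suc by (simp only: yz mult_1_left)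
    have X: "C fps_X = fls_X ^ 2"
      by (simp add: C_def fls_X_power_conv_shift_1)
    have "C (cheb_fraction (Suc (Suc k)) * (1 - fps_X * cheb_fraction (Suc k))) = 1"
      unfolding cheb_fraction_Suc_mult by (simp add: C_def)
    then have inv: "C (cheb_fraction (Suc (Suc k))) * (1 - fls_X\<^sup>2 * C (cheb_fraction (Suc k))) = 1"
      unfolding X[symmetric] by (simp add: C_def fls_times_fps_to_fls)
    have "fls_X * u (Suc (Suc k)) = u (Suc k) * (1 - fls_X\<^sup>2 * C (cheb_fraction (Suc k)))"
      unfolding rec using Suc.IH by (simp add: algebra_simps power2_eq_square)
    then have "fls_X * u (Suc (Suc k)) * C (cheb_fraction (Suc (Suc k))) = u (Suc k)"
      using inv by (simp add: mult_ac)
    with \<open>u (Suc k) \<noteq> 0\<close> show ?case by simp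
  qed
qed

theorem theorem2p6:
  fixes k :: nat and \<tau> :: "nat list"
  assumes "wedge_pattern k \<tau>"
    and "avoids_pattern \<tau> [1, 3, 2]"
  shows "fls_compose_power (fps_to_fls (avoid_gf \<tau>)) 2 = R_sqrt k"
proof -
  have "length \<tau> = k"
    using assms(1) length_finite_permutations_of_set[of \<tau> "{1..k}"] by (simp add: wedge_pattern_def)
  then have gf: "avoid_gf \<tau> = cheb_fraction k"
    using avoid_gf_wedge_word[OF wedge_pattern_imp_wedge_word[OF assms]] by simp
  \<comment> \<open>This gives k > 0, so that \<open>k - 1\<close> in \<open>R_sqrt\<close> is a
    true predecessor; at k = 0 truncation would give 1/y instead of 0.\<close>
  have "\<tau> \<noteq> []" using assms(1) unfolding wedge_pattern_def
    by (auto simp: neq_Nil_conv)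
  with \<open>length \<tau> = k\<close> obtain j where "k = Suc j" by (cases k) auto
  then show ?thesis
    using fls_compose_power_cheb_fraction[of j] unfolding gf R_sqrt_def by (auto simp: field_simps)
qed

end
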